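(* Let $G$ be a hypergraph on $[n]$ and $P_G=\sum_{U\in G}\Delta_U$ its hypergraphic polytope. Then $P_G$ is a simple polytope if and only if for every $\mathcal O\in\mathfrak O_0(G)$ the Hasse diagram $\mathrm{Hasse}(G/\mathcal O)$ is a forest.
   Context: A hypergraph on $[n]$ is a set $G$ of subsets of $[n]$ each of size at least $2$. $\Delta_U=\mathrm{conv}\{e_i: i\in U\}\subset\mathbb R^n$ and the sum is Minkowski sum. An orientation $\mathcal O$ of $G$ chooses for each $U\in G$ an ordered pair $(\mathfrak a_U,\mathfrak b_U)$ of nonempty disjoint sets with union $U$ (head $\mathfrak a_U$). $V/\mathcal O$ is the partition of $[n]$ generated by the transitive closure of $a\sim a'$ whenever $a,a'$ lie in a common head; $G/\mathcal O$ is the directed multigraph on $V/\mathcal O$ with, for each $U$ and each $b\in\mathfrak b_U$, an arrow from the class of $\mathfrak a_U$ to the class of $b$ (loops allowed). $\mathcal O$ is acyclic if $G/\mathcal O$ has no directed cycle (loops count). $\mathfrak O_0(G)$ is the set of acyclic orientations $\mathcal O$ of $G$ with $|V/\mathcal O|=n$, i.e. all heads are singletons, so $G/\mathcal O$ is a directed acyclic graph on $[n]$. $\mathrm{Hasse}(G/\mathcal O)$ is the Hasse diagram (transitive reduction) of the partial order on $[n]$ in which $u\le v$ iff there is a directed path from $u$ to $v$ in $G/\mathcal O$; it is a forest if its underlying undirected graph has no cycle. A $d$-dimensional polytope is simple if each vertex lies on exactly $d$ edges. *)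

theory Defs
  imports "Graph_Theory.Digraph_Component" "HOL-Analysis.Analysis"
begin

text \<open>
  The ground set $[n]$ is the universe of a finite type \<^typ>\<open>'n\<close> with \<open>n = CARD('n)\<close>,
  so that $R^n$ is \<^typ>\<open>real ^ 'n\<close>.
\<close>

definition hypergraph :: "'n::finite set set \<Rightarrow> bool" where
  "hypergraph G \<longleftrightarrow> (\<forall>U\<in>G. 2 \<le> card U)"

definition simplex_on :: "'n::finite set \<Rightarrow> (real ^ 'n) set" where
  "simplex_on U = convex hull ((\<lambda>i. axis i 1) ` U)"

text \<open>The sum is the Minkowski sum from \<^theory>\<open>HOL-Library.Set_Algebras\<close>; it is \<open>{0}\<close> for empty \<open>G\<close>.\<close>

definition hypergraphic_polytope :: "'n::finite set set \<Rightarrow> (real ^ 'n) set" where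
  "hypergraphic_polytope G = (\<Sum>U\<in>G. simplex_on U)"

definition simple_polytope :: "'a::euclidean_space set \<Rightarrow> bool" where
  "simple_polytope P \<longleftrightarrow> polytope P \<and>
     (\<forall>v. v extreme_point_of P \<longrightarrow> int (card {e. e edge_of P \<and> v \<in> e}) = aff_dim P)"

type_synonym 'n orientation = "'n set \<Rightarrow> 'n set \<times> 'n set"

definition orientations :: "'n set set \<Rightarrow> 'n orientation set" where
  "orientations G =
     (\<Pi>\<^sub>E U\<in>G. {(a, b). a \<noteq> {} \<and> b \<noteq> {} \<and> a \<inter> b = {} \<and> a \<union> b = U})"

definition head_equiv :: "'n set set \<Rightarrow> 'n orientation \<Rightarrow> 'n rel" where
  "head_equiv G \<O> = {(a, a'). \<exists>U\<in>G. a \<in> fst (\<O> U) \<and> a' \<in> fst (\<O> U)}\<^sup>*"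

text \<open>
  Following the convention for hypergraph orientations, the first component of \<open>\<O> U\<close> is the
  head of \<open>U\<close>, and arcs point away from it: its class is the \<^const>\<open>tail\<close> of the
  arcs coming from \<open>U\<close>.
\<close>

definition orientation_quotient ::
    "'n set set \<Rightarrow> 'n orientation \<Rightarrow> ('n set, 'n set \<times> 'n) pre_digraph" where
  "orientation_quotient G \<O> =
     \<lparr> verts = UNIV // head_equiv G \<O>,
       arcs = (SIGMA U:G. snd (\<O> U)),
       tail = (\<lambda>(U, b). head_equiv G \<O> `` fst (\<O> U)),
       head = (\<lambda>(U, b). head_equiv G \<O> `` {b}) \<rparr>"

definition acyclic_orientation :: "'n set set \<Rightarrow> 'n orientation \<Rightarrow> bool" where
  "acyclic_orientation G \<O> \<longleftrightarrow> \<not> (\<exists>p. pre_digraph.cycle (orientation_quotient G \<O>) p)"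

definition acyclic_orientations0 :: "'n::finite set set \<Rightarrow> 'n orientation set" where
  "acyclic_orientations0 G =
     {\<O> \<in> orientations G. acyclic_orientation G \<O> \<and> card (UNIV // head_equiv G \<O>) = CARD('n)}"

text \<open>
  The order and its Hasse diagram are meant for \<open>\<O> \<in> acyclic_orientations0 G\<close>, where every class
  is a singleton and \<open>u\<close> is identified with its class.
\<close>

definition path_le :: "'n set set \<Rightarrow> 'n orientation \<Rightarrow> 'n \<Rightarrow> 'n \<Rightarrow> bool" where
  "path_le G \<O> u v \<longleftrightarrow>
     reachable (orientation_quotient G \<O>) (head_equiv G \<O> `` {u}) (head_equiv G \<O> `` {v})"

definition hasse :: "('a \<Rightarrow> 'a \<Rightarrow> bool) \<Rightarrow> 'a pair_pre_digraph" where
  "hasse le =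
     \<lparr> pverts = UNIV,
       parcs = {(u, v). le u v \<and> u \<noteq> v \<and> \<not> (\<exists>w. w \<noteq> u \<and> w \<noteq> v \<and> le u w \<and> le w v)} \<rparr>"

text \<open>
  In the symmetric digraph underlying a simple graph, the closed walk $a, b, a$ is a
  \<^const>\<open>pre_digraph.cycle\<close>, so \<^const>\<open>forest\<close> is not the undirected notion; the
  undirected cycles are the ones of length at least 3.
\<close>

definition undirected_forest :: "('a, 'b) pre_digraph \<Rightarrow> bool" where
  "undirected_forest D \<longleftrightarrow>
     \<not> (\<exists>p. pre_digraph.cycle (with_proj (mk_symmetric D)) p \<and> 3 \<le> length p)"

end

theory Submission
  imports Defs
begin

text \<open>
  The vertices of the polytope are the points \<open>\<Sum>U\<in>G. e\<^bsub>h U\<^esub>\<close> for choices of singleton heads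
  \<open>h U \<in> U\<close> whose arcs \<open>h U \<rightarrow> b\<close> form an acyclic relation: a linear functional exposing the vertex
  decreases along every arc. Moving the head of \<open>U\<close> to \<open>b\<close> translates the vertex by
  \<open>e\<^bsub>b\<^esub> - e\<^bsub>h U\<^esub>\<close>, so the cone at the vertex is generated by the vectors of the arcs, hence by the
  vectors \<open>e\<^bsub>w\<^esub> - e\<^bsub>u\<^esub>\<close> of the Hasse arcs \<open>u \<rightarrow> w\<close>. Each of these spans an extreme ray: contracting
  a covering pair leaves a partial order, and any function that decreases along this order is a functional
  vanishing on that arc and negative on all the others. So the edges at the vertex correspond to
  the Hasse arcs, while the dimension of the polytope is the rank of their vectors. The two numbers
  agree iff the vectors are linearly independent, which is the case iff the Hasse diagram is a
  forest.
\<close>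

section \<open>The cone at a vertex of a polytope\<close>

text \<open>Nonnegative combinations indexed by all of \<open>D\<close> already form a convex cone
  containing \<open>D\<close>, so minimality of the hull applies.\<close>

lemma convex_cone_hull_finite_sum:
  fixes D :: "'a::real_vector set"
  assumes "finite D" "x \<in> convex_cone hull D"
  obtains c where "\<forall>d\<in>D. 0 \<le> c d" "x = (\<Sum>d\<in>D. c d *\<^sub>R d)"
proof -
  let ?K = "{\<Sum>d\<in>D. c d *\<^sub>R d |c. \<forall>d\<in>D. 0 \<le> c d}"
  have "D \<subseteq> ?K"
  proof
    fix d assume "d \<in> D"
    then have "d = (\<Sum>e\<in>D. (if e = d then 1 else 0) *\<^sub>R e)"
      using assms(1) by (simp add: if_distrib[of "\<lambda>c. c *\<^sub>R _"] cong: if_cong)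
    then show "d \<in> ?K" by (auto intro!: exI[of _ "\<lambda>e. if e = d then 1 else 0"])
  qed
  moreover have "convex_cone ?K"
    unfolding convex_cone_iff
  proof (intro conjI ballI allI impI)
    show "0 \<in> ?K" by (auto intro!: exI[of _ "\<lambda>_. 0"])
    fix x assume "x \<in> ?K"
    then obtain c where c: "\<forall>d\<in>D. 0 \<le> c d" "x = (\<Sum>d\<in>D. c d *\<^sub>R d)" by blast
    show "x + y \<in> ?K" if y: "y \<in> ?K" for y
    proof -
      obtain c' where c': "\<forall>d\<in>D. 0 \<le> c' d" "y = (\<Sum>d\<in>D. c' d *\<^sub>R d)" using y by blast
      have "x + y = (\<Sum>d\<in>D. (c d + c' d) *\<^sub>R d)"
        by (simp add: c c' scaleR_add_left sum.distrib)
      moreover have "\<forall>d\<in>D. 0 \<le> c d + c' d" using c c' by simp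
      ultimately show ?thesis by (intro CollectI exI[of _ "\<lambda>d. c d + c' d"]) blast
    qed
    show "r *\<^sub>R x \<in> ?K" if "0 \<le> r" for r
    proof -
      have "r *\<^sub>R x = (\<Sum>d\<in>D. (r * c d) *\<^sub>R d)"
        by (simp add: c scaleR_sum_right)
      moreover have "\<forall>d\<in>D. 0 \<le> r * c d" using c that by simp
      ultimately show ?thesis by (intro CollectI exI[of _ "\<lambda>d. r * c d"]) blast
    qed
  qed
  ultimately have "convex_cone hull D \<subseteq> ?K" by (rule hull_minimal)
  with assms(2) that show ?thesis by blast
qed

text \<open>Local count of edges. \<open>pointed\<close> makes \<open>v\<close> a vertex, and
  \<open>rays\<close> makes every generator span its own exposed ray, so none is redundant. By
  \<open>dirs\<close> each ray begins with a segment inside \<open>P\<close>, which turns extreme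
  rays of the cone into edges of the polytope.\<close>

lemma vertex_cone_edges:
  fixes v :: "'a::euclidean_space"
  assumes P: "polytope P" and v: "v \<in> P" and D: "finite D"
    and dirs: "\<And>d. d \<in> D \<Longrightarrow> v + d \<in> P"
    and cone: "\<And>x. x \<in> P \<Longrightarrow> x - v \<in> convex_cone hull D"
    and pointed: "\<exists>l. \<forall>d\<in>D. l \<bullet> d < 0"
    and rays: "\<And>d. d \<in> D \<Longrightarrow> \<exists>m. m \<bullet> d = 0 \<and> (\<forall>d'\<in>D - {d}. m \<bullet> d' < 0)"
  shows "v extreme_point_of P"
    and "card {e. e edge_of P \<and> v \<in> e} = card D"
    and "aff_dim P = int (dim D)"
proof -
  have cvx: "convex P"
    using P by (rule polytope_imp_convex)
  have gen: "\<exists>c. (\<forall>d\<in>D. 0 \<le> c d) \<and> x - v = (\<Sum>d\<in>D. c d *\<^sub>R d)" if "x \<in> P" for x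
    by (rule convex_cone_hull_finite_sum[OF D cone[OF that]]) (intro exI conjI)
  have le: "a \<bullet> x \<le> a \<bullet> v" if "\<forall>d\<in>D. a \<bullet> d \<le> 0" "x \<in> P" for a x
  proof -
    from gen[OF that(2)] obtain c where c: "\<forall>d\<in>D. 0 \<le> c d" "x - v = (\<Sum>d\<in>D. c d *\<^sub>R d)"
      by blast
    have "a \<bullet> (x - v) = (\<Sum>d\<in>D. c d * (a \<bullet> d))"
      unfolding c(2) by (simp add: inner_sum_right)
    also have "\<dots> \<le> 0"
      using that c by (intro sum_nonpos) (simp add: mult_nonneg_nonpos)
    finally show ?thesis by (simp add: inner_diff_right)
  qed
  \<comment> \<open>Complementary slackness: a vanishing sum of nonpositive terms vanishes termwise,
    so on the supporting hyperplane of \<open>a\<close> only generators orthogonal to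
    \<open>a\<close> carry weight.\<close>
  have eqD: "c d * (a \<bullet> d) = 0"
    if "\<forall>d\<in>D. a \<bullet> d \<le> 0" "\<forall>d\<in>D. 0 \<le> c d" "x - v = (\<Sum>d\<in>D. c d *\<^sub>R d)" "a \<bullet> x = a \<bullet> v" "d \<in> D"
    for a x c d
  proof -
    have "(\<Sum>d\<in>D. - (c d * (a \<bullet> d))) = - (a \<bullet> (x - v))"
      unfolding that(3) by (simp add: inner_sum_right sum_negf)
    also have "\<dots> = 0" using that(4) by (simp add: inner_diff_right)
    finally have "\<forall>d\<in>D. - (c d * (a \<bullet> d)) = 0"
      using that D by (subst (asm) sum_nonneg_eq_0_iff) (auto simp: mult_nonneg_nonpos)
    with that show ?thesis by simp
  qed
  obtain l where l: "\<forall>d\<in>D. l \<bullet> d < 0" using pointed by blast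
  have "P \<inter> {x. l \<bullet> x = l \<bullet> v} = {v}"
  proof -
    have "x = v" if x: "x \<in> P" "l \<bullet> x = l \<bullet> v" for x
    proof -
      obtain c where c: "\<forall>d\<in>D. 0 \<le> c d" "x - v = (\<Sum>d\<in>D. c d *\<^sub>R d)"
        using gen[OF x(1)] by blast
      have "c d = 0" if "d \<in> D" for d
        using eqD[OF _ c x(2) that] l that by (force simp: less_imp_le)
      with c show ?thesis by simp
    qed
    with v show ?thesis by blast
  qed
  moreover have "P \<inter> {x. l \<bullet> x = l \<bullet> v} face_of P"
    using l by (intro face_of_Int_supporting_hyperplane_le cvx le) (auto simp: less_imp_le)
  ultimately show "v extreme_point_of P"
    by (simp add: face_of_singleton)
  have span: "span ((\<lambda>x. x - v) ` P) = span D"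
  proof (rule span_eq[THEN iffD2], intro conjI subsetI)
    fix y assume "y \<in> (\<lambda>x. x - v) ` P"
    then obtain x where "x \<in> P" "y = x - v" by blast
    with gen[of x] show "y \<in> span D"
      by (auto intro!: span_sum span_scale intro: span_base)
  next
    fix d assume "d \<in> D"
    then have "d \<in> (\<lambda>x. x - v) ` P"
      using dirs[of d] by (force intro!: image_eqI[of _ _ "v + d"])
    then show "d \<in> span ((\<lambda>x. x - v) ` P)" by (rule span_base)
  qed
  show "aff_dim P = int (dim D)"
    using aff_dim_eq_dim_subtract[of v P] v span
    by (metis dim_span hull_inc)
  obtain m where m: "\<And>d. d \<in> D \<Longrightarrow> m d \<bullet> d = 0" "\<And>d d'. d \<in> D \<Longrightarrow> d' \<in> D \<Longrightarrow> d' \<noteq> d \<Longrightarrow> m d \<bullet> d' < 0"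
    using rays by (metis Diff_iff singletonD)
  have mle: "\<forall>d'\<in>D. m d \<bullet> d' \<le> 0" if "d \<in> D" for d
    using m that by (metis less_eq_real_def)
  \<comment> \<open>The face exposed by \<open>m d\<close>; it turns out to be the edge leaving
    \<open>v\<close> in direction \<open>d\<close>.\<close>
  define F where "F d = P \<inter> {x. m d \<bullet> x = m d \<bullet> v}" for d
  have F_face: "F d face_of P" if "d \<in> D" for d
    unfolding F_def using that by (intro face_of_Int_supporting_hyperplane_le cvx le mle)
  have in_F: "v \<in> F d" "v + d \<in> F d" if "d \<in> D" for d
    using that v dirs m by (auto simp: F_def inner_add_right)
  have nz: "d \<noteq> 0" if "d \<in> D" for d
    using l that by force
  have F_line: "F d \<subseteq> affine hull {v, v + d}" if d: "d \<in> D" for d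
  proof
    fix x assume x: "x \<in> F d"
    then obtain c where c: "\<forall>d\<in>D. 0 \<le> c d" "x - v = (\<Sum>d\<in>D. c d *\<^sub>R d)"
      using gen[of x] by (auto simp: F_def)
    \<comment> \<open>Slackness for \<open>m d\<close> kills every coefficient except that of
      \<open>d\<close>.\<close>
    have "c d' = 0" if "d' \<in> D - {d}" for d'
      using eqD[OF mle[OF d] c _, of d'] x m(2)[OF d, of d'] that by (auto simp: F_def)
    then have "x - v = (\<Sum>d\<in>{d}. c d *\<^sub>R d)"
      unfolding c(2) using d D by (intro sum.mono_neutral_right) auto
    then have "x = (1 - c d) *\<^sub>R v + c d *\<^sub>R (v + d)"
      by (simp add: algebra_simps)
    then show "x \<in> affine hull {v, v + d}"
      unfolding affine_hull_2 by (intro CollectI exI[of _ "1 - c d"] exI[of _ "c d"]) simp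
  qed
  have F_edge: "F d edge_of P" if d: "d \<in> D" for d
  proof -
    have "aff_dim (F d) \<le> aff_dim {v, v + d}"
      using aff_dim_subset[OF F_line[OF d]] by simp
    moreover have "aff_dim {v, v + d} \<le> aff_dim (F d)"
      using in_F[OF d] by (intro aff_dim_subset) auto
    moreover have "aff_dim {v, v + d} = 1"
      using nz[OF d] by (simp add: aff_dim_2)
    ultimately show ?thesis
      using F_face[OF d] by (simp add: edge_of_def)
  qed
  have "inj_on F D"
  proof (rule inj_onI, rule ccontr)
    fix d d' assume dd': "d \<in> D" "d' \<in> D" "F d = F d'" "d \<noteq> d'"
    then have "v + d' \<in> F d" using in_F(2)[of d'] by simp
    then have "m d \<bullet> d' = 0" by (simp add: F_def inner_add_right)
    with m(2)[of d d'] dd' show False by simp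
  qed
  moreover have "F ` D = {e. e edge_of P \<and> v \<in> e}"
  proof (intro equalityI subsetI)
    fix e assume "e \<in> F ` D"
    then show "e \<in> {e. e edge_of P \<and> v \<in> e}" using F_edge in_F by auto
  next
    fix e assume "e \<in> {e. e edge_of P \<and> v \<in> e}"
    then have e: "e face_of P" "aff_dim e = 1" "v \<in> e" by (auto simp: edge_of_def)
    then obtain a b where ab: "P \<subseteq> {x. a \<bullet> x \<le> b}" "e = P \<inter> {x. a \<bullet> x = b}"
      using exposed_face_of_polyhedron[OF polytope_imp_polyhedron[OF P], of e]
      by (auto simp: exposed_face_of_def)
    \<comment> \<open>A second point of \<open>e\<close> gives some \<open>d\<close> positive
      weight; slackness then puts \<open>d\<close> into the hyperplane exposing \<open>e\<close>, so
      \<open>e\<close> contains \<open>v + d\<close>.\<close>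
    have "e \<noteq> {v}" using e by auto
    then obtain y where y: "y \<in> e" "y \<noteq> v" using e by blast
    then obtain c where c: "\<forall>d\<in>D. 0 \<le> c d" "y - v = (\<Sum>d\<in>D. c d *\<^sub>R d)"
      using gen[of y] ab by blast
    obtain d where d: "d \<in> D" "c d \<noteq> 0"
      using c y by (metis (no_types, lifting) eq_iff_diff_eq_0 scale_eq_0_iff sum.neutral)
    have av: "a \<bullet> v = b" using e ab by auto
    have "\<forall>d\<in>D. a \<bullet> d \<le> 0"
      using dirs ab(1) av by (fastforce simp: inner_add_right)
    from eqD[OF this c _ d(1)] y ab av d have "a \<bullet> d = 0" by auto
    then have vd: "v + d \<in> e" using dirs d ab av by (auto simp: inner_add_right)
    have Fd: "F d face_of P" "aff_dim (F d) = 1"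
      using F_edge[OF d(1)] by (auto simp: edge_of_def)
    have "aff_dim {v, v + d} \<le> aff_dim (e \<inter> F d)"
      using in_F[OF d(1)] vd e by (intro aff_dim_subset) auto
    then have dim1: "1 \<le> aff_dim (e \<inter> F d)"
      using nz[OF d(1)] by (simp add: aff_dim_2)
    have int: "e \<inter> F d face_of P"
      by (intro face_of_Int e Fd)
    \<comment> \<open>A proper face of a one-dimensional face has smaller dimension, but the
      intersection contains the segment from \<open>v\<close> to \<open>v + d\<close>. Hence
      \<open>e\<close> and \<open>F d\<close> both equal it.\<close>
    have "e \<inter> F d = T" if "T face_of P" "aff_dim T = 1" "e \<inter> F d \<subseteq> T" for T
    proof (rule ccontr)
      assume "e \<inter> F d \<noteq> T"
      moreover have "e \<inter> F d face_of T"
        using int that face_of_imp_subset by (blast intro: face_of_subset)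
      ultimately have "aff_dim (e \<inter> F d) < aff_dim T"
        using face_of_imp_convex[OF that(1)] by (intro face_of_aff_dim_lt)
      with dim1 that show False by simp
    qed
    from this[of e] this[of "F d"] e Fd have "e = F d" by blast
    with d show "e \<in> F ` D" by blast
  qed
  ultimately show "card {e. e edge_of P \<and> v \<in> e} = card D"
    by (metis card_image)
qed

section \<open>Arc vectors and forests\<close>

text \<open>The column of the arc in the incidence matrix; pairing with \<open>x\<close> gives the
  increase of \<open>x\<close> along the arc.\<close>

definition arc_vec :: "'n::finite \<times> 'n \<Rightarrow> real ^ 'n" where
  "arc_vec a = axis (snd a) 1 - axis (fst a) 1"

lemma inner_arc_vec: "x \<bullet> arc_vec (u, w) = x $ w - x $ u"
  by (simp add: arc_vec_def inner_diff_right inner_axis)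

lemma arc_vec_swap: "arc_vec (w, u) = - arc_vec (u, w)"
  by (simp add: arc_vec_def)

lemma arc_vec_add: "arc_vec (u, v) + arc_vec (v, w) = arc_vec (u, w)"
  by (simp add: arc_vec_def)

lemma arc_vec_refl [simp]: "arc_vec (u, u) = 0"
  by (simp add: arc_vec_def)

text \<open>The coordinates -1 and 1 locate both ends of the arc. The pair \<open>a\<close> may be a
  loop, whose vector is zero.\<close>

lemma arc_vec_eq_iff:
  assumes "u \<noteq> w"
  shows "arc_vec (u, w) = arc_vec a \<longleftrightarrow> a = (u, w)"
proof
  assume eq: "arc_vec (u, w) = arc_vec a"
  obtain u' w' where a: "a = (u', w')" by (cases a)
  have "axis u 1 \<bullet> arc_vec (u, w) = axis u 1 \<bullet> arc_vec (u', w')"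
    and "axis w 1 \<bullet> arc_vec (u, w) = axis w 1 \<bullet> arc_vec (u', w')"
    using eq a by simp_all
  with assms a show "a = (u, w)"
    unfolding inner_arc_vec by (auto simp: axis_def split: if_splits)
qed simp

lemma inj_on_arc_vec: "irrefl H \<Longrightarrow> inj_on arc_vec H"
  by (rule inj_onI) (metis arc_vec_eq_iff irreflD surj_pair)

text \<open>Arc vectors telescope along a walk that ignores directions; conversely, a functional
  constant on components separates vertices that no walk joins.\<close>

lemma arc_vec_in_span_iff:
  "arc_vec (u, w) \<in> span (arc_vec ` R) \<longleftrightarrow> (u, w) \<in> (R \<union> R\<inverse>)\<^sup>*"
proof
  assume "(u, w) \<in> (R \<union> R\<inverse>)\<^sup>*"
  then show "arc_vec (u, w) \<in> span (arc_vec ` R)"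
  proof induction
    case (step y z)
    have "arc_vec (y, z) \<in> span (arc_vec ` R)"
    proof (cases "(y, z) \<in> R")
      case False
      then have "(z, y) \<in> R" using step.hyps by auto
      then show ?thesis
        unfolding arc_vec_swap[of y z] by (intro span_neg span_base imageI)
    qed (auto intro: span_base)
    with step.IH have "arc_vec (u, y) + arc_vec (y, z) \<in> span (arc_vec ` R)"
      by (rule span_add)
    then show ?case by (simp add: arc_vec_add)
  qed (simp add: span_zero)
next
  assume mem: "arc_vec (u, w) \<in> span (arc_vec ` R)"
  \<comment> \<open>The indicator vector of the component of \<open>u\<close> is orthogonal to every arc of \<open>R\<close>.\<close>
  define x :: "real ^ 'a" where "x = (\<chi> i. if (u, i) \<in> (R \<union> R\<inverse>)\<^sup>* then 1 else 0)"
  have "x \<bullet> arc_vec (a, b) = 0" if "(a, b) \<in> R" for a b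
  proof -
    have "(u, a) \<in> (R \<union> R\<inverse>)\<^sup>* \<longleftrightarrow> (u, b) \<in> (R \<union> R\<inverse>)\<^sup>*"
      using that by (blast intro: rtrancl_into_rtrancl)
    then show ?thesis by (simp add: inner_arc_vec x_def)
  qed
  then have "\<And>y. y \<in> arc_vec ` R \<Longrightarrow> x \<bullet> y = 0" by auto
  then have "x \<bullet> arc_vec (u, w) = 0"
    using span_induct[OF mem, of "\<lambda>y. x \<bullet> y = 0"] by (simp add: subspace_hyperplane)
  then show "(u, w) \<in> (R \<union> R\<inverse>)\<^sup>*"
    by (simp add: inner_arc_vec x_def split: if_splits)
qed

section \<open>Undirected cycles and deletion of arcs\<close>

lemma mk_symmetric_with_proj:
  "mk_symmetric (with_proj \<lparr>pverts = V, parcs = H\<rparr>) = \<lparr>pverts = V, parcs = H \<union> H\<inverse>\<rparr>"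
  by (auto simp: mk_symmetric_def)

text \<open>An arc lies on an undirected cycle exactly when its ends stay connected after its
  deletion. Asymmetry excludes antiparallel pairs, which would reconnect the ends without giving a
  cycle of length at least 3.\<close>

lemma undirected_forest_iff:
  assumes "asym H"
  shows "undirected_forest (with_proj \<lparr>pverts = UNIV, parcs = H\<rparr>) \<longleftrightarrow>
    (\<forall>a\<in>H. a \<notin> ((H - {a}) \<union> (H - {a})\<inverse>)\<^sup>*)"
proof -
  define S where "S E = with_proj \<lparr>pverts = UNIV :: 'a set, parcs = E\<rparr>" for E :: "'a rel"
  have wf: "wf_digraph (S E)" for E by (simp add: S_def wf_digraph_def)
  have S_simps: "verts (S E) = UNIV" "arcs (S E) = E" "tail (S E) = fst" "head (S E) = snd"
      "arcs_ends (S E) = E" for E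
    by (simp_all add: S_def)
  \<comment> \<open>Walk predicates read only \<open>tail\<close> and \<open>head\<close>, which
    every \<open>S E\<close> shares, so walks transfer between arc sets.\<close>
  have cas_eq: "pre_digraph.cas (S E) = pre_digraph.cas (S E')" for E E'
  proof (intro ext)
    show "pre_digraph.cas (S E) x p y = pre_digraph.cas (S E') x p y" for x p y
      by (induction p arbitrary: x) (simp_all add: pre_digraph.cas.simps S_simps)
  qed
  have verts_eq: "pre_digraph.awalk_verts (S E) = pre_digraph.awalk_verts (S E')" for E E'
  proof (intro ext)
    show "pre_digraph.awalk_verts (S E) x p = pre_digraph.awalk_verts (S E') x p" for x p
      by (induction p arbitrary: x) (simp_all add: pre_digraph.awalk_verts.simps S_simps)
  qed
  interpret wf_digraph "S (H \<union> H\<inverse>)" by (rule wf)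
  have "(\<exists>p. cycle p \<and> 3 \<le> length p) \<longleftrightarrow> (\<exists>a\<in>H. a \<in> ((H - {a}) \<union> (H - {a})\<inverse>)\<^sup>*)"
  proof
    assume "\<exists>p. cycle p \<and> 3 \<le> length p"
    then obtain u p where up: "awalk u p u" "distinct (tl (awalk_verts u p))" "3 \<le> length p"
      by (auto simp: cycle_def)
    \<comment> \<open>Once \<open>(x, y)\<close> is deleted, \<open>(y, z) # q\<close> still leads
      from \<open>y\<close> back to \<open>x\<close>.\<close>
    then obtain x y z q where p: "p = (x, y) # (y, z) # q"
      by (cases p; cases "tl p") (auto simp: awalk_Cons_iff S_simps)
    have arcs: "(x, y) \<in> H \<union> H\<inverse>" "(y, z) \<in> H \<union> H\<inverse>" and ux: "u = x"
      and q: "apath z q x" and y: "y \<notin> set (awalk_verts z q)"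
      using up by (auto simp: p apath_def awalk_Cons_iff S_simps)
    have "q \<noteq> []" using up p by auto
    then have "z \<noteq> x" using apath_nonempty_ends[OF q] by blast
    have "z \<noteq> y" using y hd_in_awalk_verts(2)[OF q] by blast
    \<comment> \<open>Both directions go, since either of them may be the arc in
      \<open>H\<close>.\<close>
    define R where "R = H - {(x, y), (y, x)}"
    \<comment> \<open>The rest of the cycle never returns to \<open>y\<close>, so it uses neither
      direction of the deleted arc.\<close>
    have "set q \<subseteq> R \<union> R\<inverse>"
    proof
      fix a assume a: "a \<in> set q"
      have qw: "awalk z q x" using q by (simp add: apath_def)
      then have "fst a \<noteq> y" "snd a \<noteq> y"
        using y a set_awalk_verts[OF qw] by (auto simp: S_simps)
      moreover have "a \<in> H \<union> H\<inverse>" using qw a by (auto simp: awalk_def S_simps)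
      ultimately show "a \<in> R \<union> R\<inverse>" by (cases a) (auto simp: R_def)
    qed
    moreover have "(y, z) \<in> R \<union> R\<inverse>" using arcs \<open>z \<noteq> x\<close> \<open>z \<noteq> y\<close> by (auto simp: R_def)
    ultimately have "pre_digraph.awalk (S (R \<union> R\<inverse>)) y ((y, z) # q) x"
      using q unfolding pre_digraph.awalk_def cas_eq[of "R \<union> R\<inverse>" "H \<union> H\<inverse>"]
      by (auto simp: apath_def awalk_def S_simps)
    then have "(y, x) \<in> (R \<union> R\<inverse>)\<^sup>+"
      using wf_digraph.reachable1_awalkI[OF wf, of "R \<union> R\<inverse>" y "(y, z) # q" x] by (simp add: S_simps)
    then have yx: "(y, x) \<in> (R \<union> R\<inverse>)\<^sup>*" by (rule trancl_into_rtrancl)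
    moreover have "sym ((R \<union> R\<inverse>)\<^sup>*)" by (rule sym_rtrancl) (auto simp: sym_def)
    ultimately have xy: "(x, y) \<in> (R \<union> R\<inverse>)\<^sup>*" by (rule symD[rotated])
    have "(R \<union> R\<inverse>)\<^sup>* \<subseteq> ((H - {a}) \<union> (H - {a})\<inverse>)\<^sup>*" if "a \<in> {(x, y), (y, x)}" for a
      using that by (intro rtrancl_mono) (auto simp: R_def)
    with xy yx arcs show "\<exists>a\<in>H. a \<in> ((H - {a}) \<union> (H - {a})\<inverse>)\<^sup>*" by blast
  next
    assume "\<exists>a\<in>H. a \<in> ((H - {a}) \<union> (H - {a})\<inverse>)\<^sup>*"
    then obtain u w where uw: "(u, w) \<in> H"
      and con: "(u, w) \<in> ((H - {(u, w)}) \<union> (H - {(u, w)})\<inverse>)\<^sup>*"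
      by force
    define R where "R = H - {(u, w)}"
    have not_sym: "(w, u) \<notin> H" using assms uw by (rule asymD)
    then have "u \<noteq> w" using uw by blast
    have "sym ((R \<union> R\<inverse>)\<^sup>*)" by (rule sym_rtrancl) (auto simp: sym_def)
    with con have "(w, u) \<in> (R \<union> R\<inverse>)\<^sup>*" unfolding R_def by (rule symD[rotated])
    then have "w \<rightarrow>\<^sup>*\<^bsub>S (R \<union> R\<inverse>)\<^esub> u"
      by (simp add: wf_digraph.reachable_conv[OF wf] S_simps)
    then obtain q where q: "pre_digraph.apath (S (R \<union> R\<inverse>)) w q u"
      using wf_digraph.reachable_apath[OF wf] by blast
    then have q': "awalk w q u" "distinct (awalk_verts w q)" "set q \<subseteq> R \<union> R\<inverse>"
      unfolding pre_digraph.apath_def pre_digraph.awalk_def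
        cas_eq[of "R \<union> R\<inverse>" "H \<union> H\<inverse>"] verts_eq[of "R \<union> R\<inverse>" "H \<union> H\<inverse>"]
      by (auto simp: S_simps R_def)
    \<comment> \<open>An empty \<open>q\<close> would make \<open>u\<close> and \<open>w\<close>
      equal. A single arc would be \<open>(w, u)\<close>, which is neither in \<open>H\<close> by
      asymmetry nor the reverse of an arc left in \<open>R\<close>.\<close>
    have "2 \<le> length q"
    proof (rule ccontr)
      assume "\<not> 2 \<le> length q"
      then consider "q = []" | a where "q = [a]" by (cases q; cases "tl q") auto
      then show False
      proof cases
        case 1
        with q' \<open>u \<noteq> w\<close> show False by (simp add: awalk_Nil_iff)
      next
        case (2 a)
        with q' have "a = (w, u)" by (cases a) (auto simp: awalk_simps S_simps)
        with q' 2 not_sym show False by (auto simp: R_def)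
      qed
    qed
    moreover have "cycle ((u, w) # q)"
      using q' uw by (auto simp: cycle_def awalk_Cons_iff S_simps)
    ultimately show "\<exists>p. cycle p \<and> 3 \<le> length p"
      by (intro exI[of _ "(u, w) # q"]) simp
  qed
  then show ?thesis
    unfolding undirected_forest_def mk_symmetric_with_proj S_def by blast
qed

text \<open>Injectivity of \<open>arc_vec\<close> on \<open>H\<close> makes removing a vector the
  same as removing its arc, so dependence says that some arc has ends connected without it.\<close>

lemma independent_arc_vec_iff:
  fixes H :: "'n::finite rel"
  assumes "asym H"
  shows "independent (arc_vec ` H) \<longleftrightarrow> undirected_forest (with_proj \<lparr>pverts = UNIV, parcs = H\<rparr>)"
proof -
  have "irrefl H" using assms by (auto simp: irrefl_def dest: asymD)
  then have inj: "inj_on arc_vec H" by (rule inj_on_arc_vec)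
  have "arc_vec ` H - {arc_vec a} = arc_vec ` (H - {a})" if "a \<in> H" for a
    using inj_on_image_set_diff[OF inj, of H "{a}"] that by simp
  then have "independent (arc_vec ` H) \<longleftrightarrow> (\<forall>a\<in>H. arc_vec a \<notin> span (arc_vec ` (H - {a})))"
    by (auto simp: dependent_def)
  also have "\<dots> \<longleftrightarrow> (\<forall>a\<in>H. a \<notin> ((H - {a}) \<union> (H - {a})\<inverse>)\<^sup>*)"
    using arc_vec_in_span_iff by (metis surj_pair)
  finally show ?thesis by (simp add: undirected_forest_iff[OF assms])
qed

section \<open>The cone of a Hasse diagram\<close>

lemma parcs_hasse:
  "(u, v) \<in> parcs (hasse le) \<longleftrightarrow>
    le u v \<and> u \<noteq> v \<and> \<not> (\<exists>w. w \<noteq> u \<and> w \<noteq> v \<and> le u w \<and> le w v)"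
  by (simp add: hasse_def)

lemma asym_hasse: "antisymp le \<Longrightarrow> asym (parcs (hasse le))"
  by (rule asymI) (auto simp: parcs_hasse dest: antisympD)

text \<open>Induction on the size of the interval from \<open>u\<close> to \<open>v\<close>: an
  intermediate \<open>w\<close> splits it into two smaller intervals, one missing \<open>v\<close>
  and the other missing \<open>u\<close>.\<close>

lemma hasse_rtrancl:
  fixes le :: "'n::finite \<Rightarrow> 'n \<Rightarrow> bool"
  assumes "reflp le" "transp le" "antisymp le" "le u v"
  shows "(u, v) \<in> (parcs (hasse le))\<^sup>*"
  using \<open>le u v\<close>
proof (induction "card {x. le u x \<and> le x v}" arbitrary: u v rule: less_induct)
  case less
  note rta = reflpD[OF assms(1)] transpD[OF assms(2)] antisympD[OF assms(3)]
  show ?case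
  proof (cases "u = v \<or> (u, v) \<in> parcs (hasse le)")
    case False
    then obtain w where w: "w \<noteq> u" "w \<noteq> v" "le u w" "le w v"
      using less.prems by (auto simp: parcs_hasse)
    have "{x. le u x \<and> le x w} \<subset> {x. le u x \<and> le x v}"
    proof (rule psubsetI)
      show "{x. le u x \<and> le x w} \<subseteq> {x. le u x \<and> le x v}"
        using rta(2)[OF _ w(4)] by blast
      have "\<not> le v w" using w rta(3) by blast
      then show "{x. le u x \<and> le x w} \<noteq> {x. le u x \<and> le x v}"
        using less.prems rta(1)[of v] by blast
    qed
    moreover have "{x. le w x \<and> le x v} \<subset> {x. le u x \<and> le x v}"
    proof (rule psubsetI)
      show "{x. le w x \<and> le x v} \<subseteq> {x. le u x \<and> le x v}"
        using rta(2)[OF w(3)] by blast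
      have "\<not> le w u" using w rta(3) by blast
      then show "{x. le w x \<and> le x v} \<noteq> {x. le u x \<and> le x v}"
        using less.prems rta(1)[of u] by blast
    qed
    ultimately have "(u, w) \<in> (parcs (hasse le))\<^sup>*" "(w, v) \<in> (parcs (hasse le))\<^sup>*"
      using w by (auto intro!: less.hyps psubset_card_mono)
    then show ?thesis by (rule rtrancl_trans)
  qed auto
qed

text \<open>The size of the up-set is the strictly decreasing function behind all the functionals
  below. It is stated for preorders so that it also applies after a covering pair is
  contracted.\<close>

lemma card_upset_less:
  fixes le :: "'n::finite \<Rightarrow> 'n \<Rightarrow> bool"
  assumes "reflp le" "transp le" "le x y" "\<not> le y x"
  shows "card {z. le y z} < card {z. le x z}"
proof (rule psubset_card_mono)
  show "{z. le y z} \<subset> {z. le x z}"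
    using assms reflpD[OF assms(1), of x] by (auto dest: transpD)
qed simp

text \<open>A chain of covers from \<open>u\<close> to \<open>v\<close> telescopes to the vector of
  \<open>(u, v)\<close>.\<close>

lemma arc_vec_in_hasse_cone:
  fixes le :: "'n::finite \<Rightarrow> 'n \<Rightarrow> bool"
  assumes "reflp le" "transp le" "antisymp le" "le u v"
  shows "arc_vec (u, v) \<in> convex_cone hull (arc_vec ` parcs (hasse le))"
  using hasse_rtrancl[OF assms]
proof induction
  case base
  show ?case by (simp add: convex_cone_hull_contains_0)
next
  case (step y z)
  have "arc_vec (u, y) + arc_vec (y, z) \<in> convex_cone hull (arc_vec ` parcs (hasse le))"
    by (intro convex_cone_hull_add step.IH hull_inc imageI step.hyps)
  then show ?case by (simp add: arc_vec_add)
qed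

lemma hasse_cone_pointed:
  fixes le :: "'n::finite \<Rightarrow> 'n \<Rightarrow> bool"
  assumes "reflp le" "transp le" "antisymp le"
  shows "\<exists>l. \<forall>d\<in>arc_vec ` parcs (hasse le). l \<bullet> d < 0"
proof (intro exI ballI)
  fix d assume "d \<in> arc_vec ` parcs (hasse le)"
  then obtain a where a: "a \<in> parcs (hasse le)" "d = arc_vec a" by blast
  obtain x y where xy: "a = (x, y)" by (cases a)
  with a assms(3) have "le x y" "\<not> le y x" by (auto simp: parcs_hasse dest: antisympD)
  from card_upset_less[OF assms(1,2) this]
  show "(\<chi> i. real (card {z. le i z})) \<bullet> d < 0"
    by (simp add: a xy inner_arc_vec)
qed

text \<open>Merge \<open>u\<close> and \<open>w\<close> and count up-sets in the resulting preorder.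
  The count agrees at \<open>u\<close> and \<open>w\<close>, and it drops along every other Hasse
  arc because merging a covering pair identifies no further elements.\<close>

lemma hasse_cone_ray:
  fixes le :: "'n::finite \<Rightarrow> 'n \<Rightarrow> bool"
  assumes "reflp le" "transp le" "antisymp le" and uw: "(u, w) \<in> parcs (hasse le)"
  shows "\<exists>m. m \<bullet> arc_vec (u, w) = 0 \<and> (\<forall>a\<in>parcs (hasse le) - {(u, w)}. m \<bullet> arc_vec a < 0)"
proof -
  \<comment> \<open>The preorder generated by \<open>le\<close> and \<open>w \<le> u\<close>.\<close>
  define le' where "le' x y \<longleftrightarrow> le x y \<or> (le x w \<and> le u y)" for x y
  note rt = reflpD[OF assms(1)] transpD[OF assms(2)]
  have refl': "reflp le'" using rt by (auto simp: le'_def intro: reflpI)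
  have trans': "transp le'"
    by (rule transpI) (unfold le'_def, use rt in blast)
  define m :: "real ^ 'n" where "m = (\<chi> i. real (card {z. le' i z}))"
  have "Collect (le' u) = Collect (le' w)"
    using uw rt unfolding le'_def parcs_hasse by blast
  then have "m \<bullet> arc_vec (u, w) = 0"
    by (simp add: inner_arc_vec m_def)
  moreover have "m \<bullet> arc_vec a < 0" if a: "a \<in> parcs (hasse le) - {(u, w)}" for a
  proof -
    obtain x y where xy: "a = (x, y)" by (cases a)
    have le: "le x y" "x \<noteq> y" using a xy by (auto simp: parcs_hasse)
    have "\<not> le' y x"
    proof
      assume "le' y x"
      moreover have "\<not> le y x" using le assms(3) by (auto dest: antisympD)
      \<comment> \<open>If the merge identified \<open>x\<close> with \<open>y\<close>, both would
        lie between \<open>u\<close> and \<open>w\<close>; the cover then leaves only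
        \<open>u\<close> and \<open>w\<close> for them, and both assignments are excluded.\<close>
      ultimately have "le y w" "le u x" by (auto simp: le'_def)
      moreover from this le have "le u y" "le x w" using rt by blast+
      ultimately have "x \<in> {u, w}" "y \<in> {u, w}" using uw by (auto simp: parcs_hasse)
      with le \<open>\<not> le y x\<close> \<open>le u x\<close> a xy uw show False by (auto simp: parcs_hasse)
    qed
    from card_upset_less[OF refl' trans' _ this] le show ?thesis
      by (auto simp: xy inner_arc_vec m_def le'_def)
  qed
  ultimately show ?thesis by blast
qed

section \<open>Orientations with singleton heads\<close>

text \<open>The arcs of \<open>G/\<O>\<close> when \<open>h U\<close> is the only element of the
  head of \<open>U\<close>, read on points instead of singleton classes.\<close>

definition arc_rel :: "'n set set \<Rightarrow> ('n set \<Rightarrow> 'n) \<Rightarrow> 'n rel" where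
  "arc_rel G h = {(h U, b) |U b. U \<in> G \<and> b \<in> U \<and> b \<noteq> h U}"

text \<open>Every nonempty closed walk contains a cycle. Loops count on both sides.\<close>

lemma (in wf_digraph) ex_cycle_iff: "(\<exists>p. cycle p) \<longleftrightarrow> \<not> acyclic (arcs_ends G)"
proof
  assume "\<exists>p. cycle p"
  then show "\<not> acyclic (arcs_ends G)"
    unfolding cycle_def acyclic_def by (blast intro: reachable1_awalkI)
next
  assume "\<not> acyclic (arcs_ends G)"
  then obtain u p where "awalk u p u" "p \<noteq> []"
    unfolding acyclic_def reachable1_awalk by blast
  then have "closed_w p" by (auto simp: closed_w_def)
  then show "\<exists>p. cycle p" by (rule closed_w_imp_cycle)
qed

lemma rtrancl_singleton_iff:
  "({u}, {v}) \<in> (map_prod (\<lambda>x. {x}) (\<lambda>x. {x}) ` A)\<^sup>* \<longleftrightarrow> (u, v) \<in> A\<^sup>*"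
proof
  assume "(u, v) \<in> A\<^sup>*"
  then show "({u}, {v}) \<in> (map_prod (\<lambda>x. {x}) (\<lambda>x. {x}) ` A)\<^sup>*"
    by induction (force intro: rtrancl_into_rtrancl)+
next
  \<comment> \<open>The endpoint is generalised for the induction: whatever is reachable from a
    singleton is again a singleton.\<close>
  have "\<exists>v. Y = {v} \<and> (u, v) \<in> A\<^sup>*" if "({u}, Y) \<in> (map_prod (\<lambda>x. {x}) (\<lambda>x. {x}) ` A)\<^sup>*" for Y
    using that by induction (auto intro: rtrancl_into_rtrancl)
  then show "({u}, {v}) \<in> (map_prod (\<lambda>x. {x}) (\<lambda>x. {x}) ` A)\<^sup>* \<Longrightarrow> (u, v) \<in> A\<^sup>*"
    by blast
qed

lemma acyclic_singleton_iff:
  "acyclic (map_prod (\<lambda>x. {x}) (\<lambda>x. {x}) ` A) \<longleftrightarrow> acyclic A"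
proof -
  \<comment> \<open>Phrased through the reflexive closure, where no arc may have its end lead back
    to its start, acyclicity can be transported by the preceding equivalence.\<close>
  have *: "acyclic r \<longleftrightarrow> (\<forall>a\<in>r. (snd a, fst a) \<notin> r\<^sup>*)" for r :: "'c rel"
    unfolding acyclic_def by (fastforce dest: tranclD intro: rtrancl_into_trancl2)
  show ?thesis by (simp add: * rtrancl_singleton_iff)
qed

section \<open>The quotient digraph for singleton heads\<close>

context
  fixes G :: "'n::finite set set" and \<O> :: "'n orientation" and h :: "'n set \<Rightarrow> 'n"
  assumes \<O>: "\<And>U. U \<in> G \<Longrightarrow> \<O> U = ({h U}, U - {h U})"
begin

lemma head_equiv_singleton_heads: "head_equiv G \<O> = Id"
proof -
  have "x = y" if "(x, y) \<in> head_equiv G \<O>" for x y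
    using that unfolding head_equiv_def by induction (auto simp: \<O>)
  then show ?thesis by (auto simp: head_equiv_def)
qed

lemma wf_orientation_quotient: "wf_digraph (orientation_quotient G \<O>)"
  by (auto simp: wf_digraph_def orientation_quotient_def quotient_def head_equiv_singleton_heads \<O>)

lemma arcs_ends_orientation_quotient:
  "arcs_ends (orientation_quotient G \<O>) = map_prod (\<lambda>x. {x}) (\<lambda>x. {x}) ` arc_rel G h"
proof -
  have "arcs_ends (orientation_quotient G \<O>) = (\<lambda>(U, b). ({h U}, {b})) ` (SIGMA U:G. U - {h U})"
    unfolding arcs_ends_conv orientation_quotient_def head_equiv_singleton_heads
    by (intro image_cong) (auto simp: \<O>)
  also have "\<dots> = map_prod (\<lambda>x. {x}) (\<lambda>x. {x}) ` (\<lambda>(U, b). (h U, b)) ` (SIGMA U:G. U - {h U})"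
    by (simp add: image_image case_prod_unfold)
  also have "(\<lambda>(U, b). (h U, b)) ` (SIGMA U:G. U - {h U}) = arc_rel G h"
    by (auto simp: arc_rel_def)
  finally show ?thesis .
qed

lemma path_le_singleton_heads: "path_le G \<O> u v \<longleftrightarrow> (u, v) \<in> (arc_rel G h)\<^sup>*"
proof -
  have "verts (orientation_quotient G \<O>) = range (\<lambda>x. {x})"
    by (auto simp: orientation_quotient_def quotient_def head_equiv_singleton_heads)
  then show ?thesis
    unfolding path_le_def
      wf_digraph.reachable_conv[OF wf_orientation_quotient] arcs_ends_orientation_quotient
    by (simp add: head_equiv_singleton_heads rtrancl_singleton_iff)
qed

lemma acyclic_orientation_singleton_heads:
  "acyclic_orientation G \<O> \<longleftrightarrow> acyclic (arc_rel G h)"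
  by (simp add: acyclic_orientation_def wf_digraph.ex_cycle_iff[OF wf_orientation_quotient]
      arcs_ends_orientation_quotient acyclic_singleton_iff)

end

text \<open>With as many classes as points, the surjection from points to classes is
  injective.\<close>

lemma card_quotient_eq_CARD_imp_Id:
  fixes r :: "'n::finite rel"
  assumes "equiv UNIV r" "card (UNIV // r) = CARD('n)"
  shows "r = Id"
proof -
  have "UNIV // r = (\<lambda>x. r `` {x}) ` UNIV" by (auto simp: quotient_def)
  then have "inj (\<lambda>x. r `` {x})" using assms(2) by (simp add: eq_card_imp_inj_on)
  moreover have "r `` {x} = r `` {y}" if "(x, y) \<in> r" for x y
    using equiv_class_eq[OF assms(1) that] .
  ultimately have "r \<subseteq> Id" by (auto dest: injD)
  moreover have "Id \<subseteq> r" using assms(1) by (auto simp: equiv_def refl_on_def)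
  ultimately show ?thesis by blast
qed

lemma equiv_head_equiv: "equiv UNIV (head_equiv G \<O>)"
  unfolding head_equiv_def
  by (intro equivI refl_rtrancl sym_rtrancl trans_rtrancl) (auto simp: sym_def)

text \<open>Points of a common head are equivalent, and having \<open>n\<close> classes forces
  equivalent points to be equal, so every head is a singleton.\<close>

lemma acyclic_orientations0E:
  assumes "\<O> \<in> acyclic_orientations0 G"
  obtains h where "\<And>U. U \<in> G \<Longrightarrow> h U \<in> U" "\<And>U. U \<in> G \<Longrightarrow> \<O> U = ({h U}, U - {h U})"
    "acyclic (arc_rel G h)"
proof -
  have ori: "\<O> \<in> orientations G" and ac: "acyclic_orientation G \<O>"
    and card: "card (UNIV // head_equiv G \<O>) = CARD('a)"
    using assms by (auto simp: acyclic_orientations0_def)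
  have Id: "head_equiv G \<O> = Id"
    using equiv_head_equiv card by (rule card_quotient_eq_CARD_imp_Id)
  have "\<exists>x. x \<in> U \<and> \<O> U = ({x}, U - {x})" if U: "U \<in> G" for U
  proof -
    obtain a b where ab: "\<O> U = (a, b)" by (cases "\<O> U")
    have part: "a \<noteq> {}" "a \<inter> b = {}" "a \<union> b = U"
      using PiE_mem[OF ori[unfolded orientations_def] U] ab by simp_all
    have "x = y" if "x \<in> a" "y \<in> a" for x y
    proof -
      have "(x, y) \<in> head_equiv G \<O>"
        unfolding head_equiv_def using that U ab by (intro r_into_rtrancl) (auto intro!: bexI[of _ U])
      then show ?thesis by (simp add: Id)
    qed
    with part obtain x where "a = {x}" by blast
    with part ab show ?thesis by auto
  qed
  then obtain h where h: "\<And>U. U \<in> G \<Longrightarrow> h U \<in> U \<and> \<O> U = ({h U}, U - {h U})" by metis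
  moreover have "acyclic (arc_rel G h)"
    using ac acyclic_orientation_singleton_heads[of G \<O> h] h by blast
  ultimately show ?thesis using that by blast
qed

text \<open>Hyperedges of size at least 2 keep \<open>U - {h U}\<close> nonempty, and
  \<open>restrict\<close> supplies the extensionality that \<open>orientations\<close>
  demands.\<close>

lemma singleton_heads_in_acyclic_orientations0:
  assumes "hypergraph G" "\<And>U. U \<in> G \<Longrightarrow> h U \<in> U" "acyclic (arc_rel G h)"
  shows "restrict (\<lambda>U. ({h U}, U - {h U})) G \<in> acyclic_orientations0 G"
proof -
  let ?\<O> = "restrict (\<lambda>U. ({h U}, U - {h U})) G"
  have \<O>: "?\<O> U = ({h U}, U - {h U})" if "U \<in> G" for U using that by simp
  have "U - {h U} \<noteq> {}" if "U \<in> G" for U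
  proof
    assume "U - {h U} = {}"
    then have "card U \<le> card {h U}" by (intro card_mono) auto
    with assms(1) that show False by (auto simp: hypergraph_def)
  qed
  then have "?\<O> \<in> orientations G"
    using assms(2) by (auto simp: orientations_def)
  moreover have "card (UNIV // head_equiv G ?\<O>) = CARD('a)"
  proof -
    have "UNIV // (Id :: 'a rel) = range (\<lambda>x. {x})" by (auto simp: quotient_def)
    then show ?thesis
      by (simp add: head_equiv_singleton_heads[OF \<O>] card_image)
  qed
  moreover have "acyclic_orientation G ?\<O>"
    using assms(3) acyclic_orientation_singleton_heads[OF \<O>] by blast
  ultimately show ?thesis by (simp add: acyclic_orientations0_def)
qed

section \<open>Vertices of the hypergraphic polytope\<close>

definition choice_point :: "'n::finite set set \<Rightarrow> ('n set \<Rightarrow> 'n) \<Rightarrow> real ^ 'n" where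
  "choice_point G h = (\<Sum>U\<in>G. axis (h U) 1)"

text \<open>Convex hulls commute with Minkowski sums, and an element of a sum of finite sets of unit
  vectors is a choice of one index per hyperedge.\<close>

lemma hypergraphic_polytope_eq:
  fixes G :: "'n::finite set set"
  shows "hypergraphic_polytope G = convex hull {choice_point G h |h. \<forall>U\<in>G. h U \<in> U}"
proof -
  have "(\<Sum>U\<in>G. (\<lambda>i. axis i (1::real)) ` U) = {sum s G |s. \<forall>U\<in>G. s U \<in> (\<lambda>i. axis i 1) ` U}"
    by (rule set_sum_alt) simp
  also have "\<dots> = {choice_point G h |h. \<forall>U\<in>G. h U \<in> U}"
  proof (intro equalityI subsetI)
    fix x assume "x \<in> {sum s G |s. \<forall>U\<in>G. s U \<in> (\<lambda>i. axis i (1::real)) ` U}"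
    then obtain s where s: "x = sum s G" "\<forall>U\<in>G. \<exists>i. i \<in> U \<and> s U = axis i 1" by blast
    from s(2) obtain h where "\<forall>U\<in>G. h U \<in> U \<and> s U = axis (h U) 1" by metis
    with s(1) show "x \<in> {choice_point G h |h. \<forall>U\<in>G. h U \<in> U}"
      by (auto simp: choice_point_def intro!: exI[of _ h] sum.cong)
  next
    fix x :: "real ^ 'n" assume "x \<in> {choice_point G h |h. \<forall>U\<in>G. h U \<in> U}"
    then obtain h where "x = choice_point G h" "\<forall>U\<in>G. h U \<in> U" by blast
    then show "x \<in> {sum s G |s. \<forall>U\<in>G. s U \<in> (\<lambda>i. axis i 1) ` U}"
      by (auto simp: choice_point_def intro!: exI[of _ "\<lambda>U. axis (h U) 1"])
  qed
  finally show ?thesis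
    by (simp add: hypergraphic_polytope_def simplex_on_def flip: convex_hull_set_sum)
qed

lemma polytope_hypergraphic_polytope: "polytope (hypergraphic_polytope G)"
proof -
  have "finite (\<Sum>U\<in>A. (\<lambda>i. axis i (1::real)) ` U)" for A :: "'a set set"
    by (induction A rule: infinite_finite_induct) (simp_all add: finite_set_plus)
  then show ?thesis
    unfolding hypergraphic_polytope_def simplex_on_def polytope_def
    by (metis convex_hull_set_sum)
qed

lemma choice_point_in_hypergraphic_polytope:
  "(\<And>U. U \<in> G \<Longrightarrow> h U \<in> U) \<Longrightarrow> choice_point G h \<in> hypergraphic_polytope G"
  unfolding hypergraphic_polytope_eq by (blast intro: hull_inc)

lemma choice_point_update:
  assumes "U \<in> G"
  shows "choice_point G (h(U := b)) = choice_point G h + arc_vec (h U, b)"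
proof -
  have "choice_point G (h(U := b)) = axis b 1 + (\<Sum>V\<in>G - {U}. axis ((h(U := b)) V) 1)"
    using assms by (simp add: choice_point_def sum.remove)
  also have "(\<Sum>V\<in>G - {U}. axis ((h(U := b)) V) 1) = (\<Sum>V\<in>G - {U}. axis (h V) (1::real))"
    by (intro sum.cong) auto
  also have "axis b 1 + \<dots> = choice_point G h + arc_vec (h U, b)"
    using assms by (simp add: choice_point_def sum.remove[of G U] arc_vec_def)
  finally show ?thesis .
qed

lemma choice_point_add_arc_vec:
  assumes "\<And>U. U \<in> G \<Longrightarrow> h U \<in> U" "a \<in> arc_rel G h"
  shows "choice_point G h + arc_vec a \<in> hypergraphic_polytope G"
proof -
  obtain U b where U: "U \<in> G" "b \<in> U" "a = (h U, b)"
    using assms(2) by (auto simp: arc_rel_def)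
  then have "choice_point G (h(U := b)) \<in> hypergraphic_polytope G"
    using assms(1) by (intro choice_point_in_hypergraphic_polytope) auto
  then show ?thesis using U by (simp add: choice_point_update)
qed

text \<open>A functional exposing \<open>v\<close> is strictly smaller at every other point of the
  polytope, in particular at each translate of \<open>v\<close> by an arc vector. It therefore
  strictly decreases along arcs, which forbids cycles.\<close>

lemma extreme_point_hypergraphic_polytopeE:
  assumes "v extreme_point_of hypergraphic_polytope G"
  obtains h where "\<And>U. U \<in> G \<Longrightarrow> h U \<in> U" "acyclic (arc_rel G h)" "v = choice_point G h"
proof -
  let ?P = "hypergraphic_polytope G"
  obtain h where h: "\<And>U. U \<in> G \<Longrightarrow> h U \<in> U" "v = choice_point G h"
    using extreme_point_of_convex_hull assms unfolding hypergraphic_polytope_eq by blast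
  have "{v} exposed_face_of ?P"
    using assms face_of_singleton
      exposed_face_of_polyhedron[OF polytope_imp_polyhedron[OF polytope_hypergraphic_polytope]]
    by blast
  then obtain l b where l: "?P \<subseteq> {x. l \<bullet> x \<le> b}" "{v} = ?P \<inter> {x. l \<bullet> x = b}"
    by (auto simp: exposed_face_of_def)
  have "l $ y < l $ x" if xy: "(x, y) \<in> arc_rel G h" for x y
  proof -
    have "x \<noteq> y" using xy by (auto simp: arc_rel_def)
    \<comment> \<open>The loop \<open>(x, x)\<close> stands in for the zero vector.\<close>
    then have "v + arc_vec (x, y) \<noteq> v"
      using arc_vec_eq_iff[of x y "(x, x)"] by auto
    moreover have "v + arc_vec (x, y) \<in> ?P"
      unfolding h(2) by (intro choice_point_add_arc_vec h xy)
    moreover have "l \<bullet> v = b" using l(2) by blast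
    ultimately have "l \<bullet> (v + arc_vec (x, y)) \<noteq> l \<bullet> v" "l \<bullet> (v + arc_vec (x, y)) \<le> l \<bullet> v"
      using l by blast+
    then show ?thesis by (simp add: inner_add_right inner_arc_vec)
  qed
  then have "acyclic (arc_rel G h)" by (rule acyclicI_order)
  with h that show ?thesis by blast
qed

text \<open>Acyclicity makes reachability a partial order, and its Hasse arcs supply the irredundant
  generators to which the local edge count applies.\<close>

lemma edges_at_choice_point:
  fixes G :: "'n::finite set set"
  assumes h: "\<And>U. U \<in> G \<Longrightarrow> h U \<in> U" and ac: "acyclic (arc_rel G h)"
  defines "D \<equiv> arc_vec ` parcs (hasse (\<lambda>u v. (u, v) \<in> (arc_rel G h)\<^sup>*))"
  shows "choice_point G h extreme_point_of hypergraphic_polytope G"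
    and "card {e. e edge_of hypergraphic_polytope G \<and> choice_point G h \<in> e} = card D"
    and "aff_dim (hypergraphic_polytope G) = int (dim D)"
proof -
  define le where "le = (\<lambda>u v. (u, v) \<in> (arc_rel G h)\<^sup>*)"
  have "reflp le" by (simp add: le_def reflp_def)
  moreover have "transp le" unfolding le_def by (rule transpI) (rule rtrancl_trans)
  moreover have "antisymp le"
    using antisymD[OF acyclic_impl_antisym_rtrancl[OF ac]] unfolding le_def by (rule antisympI)
  ultimately have le: "reflp le" "transp le" "antisymp le" .
  have D: "D = arc_vec ` parcs (hasse le)" by (simp add: D_def le_def)
  have covers: "parcs (hasse le) \<subseteq> arc_rel G h"
  proof
    fix a assume "a \<in> parcs (hasse le)"
    moreover obtain u w where a: "a = (u, w)" by (cases a)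
    ultimately have uw: "le u w" "u \<noteq> w" "\<And>z. z \<noteq> u \<Longrightarrow> z \<noteq> w \<Longrightarrow> le u z \<Longrightarrow> \<not> le z w"
      by (auto simp: parcs_hasse)
    \<comment> \<open>The first arc of a path from \<open>u\<close> to \<open>w\<close> ends at some
      \<open>z\<close> above \<open>u\<close> and below or equal to \<open>w\<close>; since
      \<open>w\<close> covers \<open>u\<close>, this \<open>z\<close> is \<open>w\<close>.\<close>
    then obtain z where z: "(u, z) \<in> arc_rel G h" "le z w"
      unfolding le_def by (metis converse_rtranclE)
    then have "z \<noteq> u" "le u z" by (auto simp: arc_rel_def le_def)
    with uw z a show "a \<in> arc_rel G h" by blast
  qed
  have cone: "x - choice_point G h \<in> convex_cone hull D" if "x \<in> hypergraphic_polytope G" for x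
  proof -
    have "choice_point G g - choice_point G h \<in> convex_cone hull D" if g: "\<forall>U\<in>G. g U \<in> U" for g
    proof -
      have arc: "arc_vec (h U, g U) \<in> convex_cone hull D" if "U \<in> G" for U
      proof -
        have "h U = g U \<or> (h U, g U) \<in> arc_rel G h"
          using g that by (auto simp: arc_rel_def)
        then have "le (h U) (g U)" by (auto simp: le_def)
        then show ?thesis unfolding D by (rule arc_vec_in_hasse_cone[OF le])
      qed
      have "choice_point G g - choice_point G h = (\<Sum>U\<in>G. arc_vec (h U, g U))"
        by (simp add: choice_point_def arc_vec_def sum_subtractf)
      also have "(\<Sum>U\<in>A. arc_vec (h U, g U)) \<in> convex_cone hull D" if "A \<subseteq> G" for A
        using that by (induction A rule: infinite_finite_induct)
          (simp_all add: convex_cone_hull_contains_0 convex_cone_hull_add arc)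
      finally show ?thesis by simp
    qed
    then have "{choice_point G g |g. \<forall>U\<in>G. g U \<in> U}
        \<subseteq> (+) (choice_point G h) ` (convex_cone hull D)"
      by (force intro!: image_eqI[of _ _ "_ - choice_point G h"])
    \<comment> \<open>The translated cone is convex, so containing all choice points it contains
      their hull.\<close>
    then have "hypergraphic_polytope G \<subseteq> (+) (choice_point G h) ` (convex_cone hull D)"
      unfolding hypergraphic_polytope_eq
      by (intro hull_minimal convex_translation convex_convex_cone_hull)
    with that show ?thesis by auto
  qed
  have dirs: "choice_point G h + d \<in> hypergraphic_polytope G" if "d \<in> D" for d
    using that covers unfolding D by (auto intro: choice_point_add_arc_vec h)
  have rays: "\<exists>m. m \<bullet> d = 0 \<and> (\<forall>d'\<in>D - {d}. m \<bullet> d' < 0)" if d: "d \<in> D" for d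
  proof -
    obtain a where a: "a \<in> parcs (hasse le)" "d = arc_vec a" using d D by blast
    obtain u w where "a = (u, w)" by (cases a)
    with a obtain m where "m \<bullet> d = 0" "\<forall>a'\<in>parcs (hasse le) - {a}. m \<bullet> arc_vec a' < 0"
      using hasse_cone_ray[OF le, of u w] by blast
    with a show ?thesis unfolding D by blast
  qed
  have "finite D" unfolding D by simp
  note vertex_cone_edges[OF polytope_hypergraphic_polytope
      choice_point_in_hypergraphic_polytope[OF h] this dirs cone
      hasse_cone_pointed[OF le, folded D] rays]
  then show "choice_point G h extreme_point_of hypergraphic_polytope G"
    and "card {e. e edge_of hypergraphic_polytope G \<and> choice_point G h \<in> e} = card D"
    and "aff_dim (hypergraphic_polytope G) = int (dim D)"
    by blast+
qed

text \<open>A spanning set no larger than the dimension is independent; here \<open>D\<close> spans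
  its own span.\<close>

lemma independent_iff_card_eq_dim:
  fixes D :: "'a::euclidean_space set"
  assumes "finite D"
  shows "independent D \<longleftrightarrow> card D = dim D"
  using assms card_le_dim_spanning[OF order_refl span_superset, of D]
  by (auto simp: dim_eq_card_independent)

lemma simple_at_choice_point_iff:
  fixes G :: "'n::finite set set"
  assumes h: "\<And>U. U \<in> G \<Longrightarrow> h U \<in> U" and ac: "acyclic (arc_rel G h)"
  shows "int (card {e. e edge_of hypergraphic_polytope G \<and> choice_point G h \<in> e})
      = aff_dim (hypergraphic_polytope G) \<longleftrightarrow>
    undirected_forest (with_proj (hasse (\<lambda>u v. (u, v) \<in> (arc_rel G h)\<^sup>*)))"
proof -
  let ?le = "\<lambda>u v. (u, v) \<in> (arc_rel G h)\<^sup>*"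
  have "antisymp ?le"
    using acyclic_impl_antisym_rtrancl[OF ac] by (auto intro: antisympI dest: antisymD)
  moreover have "hasse ?le = \<lparr>pverts = UNIV, parcs = parcs (hasse ?le)\<rparr>"
    by (simp add: hasse_def)
  ultimately have "independent (arc_vec ` parcs (hasse ?le)) \<longleftrightarrow>
      undirected_forest (with_proj (hasse ?le))"
    using independent_arc_vec_iff[OF asym_hasse, of ?le] by simp
  then show ?thesis
    using independent_iff_card_eq_dim[of "arc_vec ` parcs (hasse ?le)"]
    by (simp add: edges_at_choice_point(2,3)[OF h ac])
qed

theorem theorem3p2:
  fixes G :: "'n::finite set set"
  assumes "hypergraph G"
  shows "simple_polytope (hypergraphic_polytope G) \<longleftrightarrow>
    (\<forall>\<O>\<in>acyclic_orientations0 G. undirected_forest (with_proj (hasse (path_le G \<O>))))"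
proof
  assume simple: "simple_polytope (hypergraphic_polytope G)"
  show "\<forall>\<O>\<in>acyclic_orientations0 G. undirected_forest (with_proj (hasse (path_le G \<O>)))"
  proof
    fix \<O> assume "\<O> \<in> acyclic_orientations0 G"
    then obtain h where h: "\<And>U. U \<in> G \<Longrightarrow> h U \<in> U" "acyclic (arc_rel G h)"
      and \<O>: "\<And>U. U \<in> G \<Longrightarrow> \<O> U = ({h U}, U - {h U})"
      by (rule acyclic_orientations0E) blast
    have "path_le G \<O> = (\<lambda>u v. (u, v) \<in> (arc_rel G h)\<^sup>*)"
      by (intro ext path_le_singleton_heads \<O>)
    moreover have "int (card {e. e edge_of hypergraphic_polytope G \<and> choice_point G h \<in> e})
        = aff_dim (hypergraphic_polytope G)"
      using simple edges_at_choice_point(1)[OF h] by (simp add: simple_polytope_def)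
    ultimately show "undirected_forest (with_proj (hasse (path_le G \<O>)))"
      using simple_at_choice_point_iff[OF h] by simp
  qed
next
  assume forest: "\<forall>\<O>\<in>acyclic_orientations0 G. undirected_forest (with_proj (hasse (path_le G \<O>)))"
  have "int (card {e. e edge_of hypergraphic_polytope G \<and> v \<in> e}) = aff_dim (hypergraphic_polytope G)"
    if ext: "v extreme_point_of hypergraphic_polytope G" for v
  proof -
    \<comment> \<open>Conversely, each vertex yields singleton heads, and these define an
      orientation to which the forest hypothesis applies.\<close>
    obtain h where h: "\<And>U. U \<in> G \<Longrightarrow> h U \<in> U" "acyclic (arc_rel G h)" and v: "v = choice_point G h"
      using extreme_point_hypergraphic_polytopeE[OF ext] by blast
    let ?\<O> = "restrict (\<lambda>U. ({h U}, U - {h U})) G"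
    have "path_le G ?\<O> x y \<longleftrightarrow> (x, y) \<in> (arc_rel G h)\<^sup>*" for x y
      by (rule path_le_singleton_heads) simp
    then have "path_le G ?\<O> = (\<lambda>u v. (u, v) \<in> (arc_rel G h)\<^sup>*)"
      by (simp add: fun_eq_iff)
    moreover have "undirected_forest (with_proj (hasse (path_le G ?\<O>)))"
      using forest singleton_heads_in_acyclic_orientations0[OF assms h] by blast
    ultimately show ?thesis
      using simple_at_choice_point_iff[OF h] by (simp add: v)
  qed
  then show "simple_polytope (hypergraphic_polytope G)"
    by (simp add: simple_polytope_def polytope_hypergraphic_polytope)
qed

end
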